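(* Let $\Omega\subset\mathbb R^2$ be a bounded, simply connected open set. (1) Let $K\ge1$ and let $\mu,\nu:\Omega\to\mathbb C$ be measurable functions satisfying $|\mu|+|\nu|\le\frac{K-1}{K+1}$ a.e. in $\Omega$. Define $$\sigma:=\begin{pmatrix}\dfrac{|1-\mu|^2-|\nu|^2}{|1+\nu|^2-|\mu|^2}&\dfrac{2\,\mathfrak{Im}(\nu-\mu)}{|1+\nu|^2-|\mu|^2}\\[2ex]\dfrac{-2\,\mathfrak{Im}(\nu+\mu)}{|1+\nu|^2-|\mu|^2}&\dfrac{|1+\mu|^2-|\nu|^2}{|1+\nu|^2-|\mu|^2}\end{pmatrix}.$$ Then $\sigma\in\mathcal M(\alpha,\beta,\Omega)$ with $\alpha=\frac1K$ and $\beta=K$. (2) Conversely, let $\lambda\in(0,1]$, let $\sigma\in\mathcal M(\lambda,\frac1\lambda,\Omega)$, and define $$\mu=\frac{\sigma_{22}-\sigma_{11}-i(\sigma_{12}+\sigma_{21})}{1+\mathrm{Tr}\,\sigma+\det\sigma},\qquad \nu=\frac{1-\det\sigma+i(\sigma_{12}-\sigma_{21})}{1+\mathrm{Tr}\,\sigma+\det\sigma}.$$ Then $|\mu|+|\nu|\le\frac{K-1}{K+1}$ a.e. in $\Omega$, with $$K=\frac{1+\sqrt{1-\lambda^2}}{\lambda}.$$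
   Context: For $\alpha,\beta>0$, $\mathcal M(\alpha,\beta,\Omega)$ is the class of measurable functions $\sigma$ on $\Omega$ with values in the real $2\times2$ matrices (not necessarily symmetric) such that, for a.e. $z\in\Omega$ and every $\xi\in\mathbb R^2$, $$\sigma(z)\xi\cdot\xi\ge\alpha|\xi|^2,\qquad \sigma^{-1}(z)\xi\cdot\xi\ge\beta^{-1}|\xi|^2.$$ $\mathfrak{Im}$ denotes the imaginary part. *)

theory Defs
  imports "HOL-Analysis.Analysis"
begin

text \<open>
  The class \<open>\<M>(\<alpha>, \<beta>, \<Omega>)\<close>, meant for \<open>\<alpha>, \<beta> > 0\<close>. Measurability and ``almost everywhere''
  refer to Lebesgue measure on \<open>\<Omega>\<close>; values outside \<open>\<Omega>\<close> are irrelevant. For \<open>\<alpha> > 0\<close> the first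
  inequality makes \<open>\<sigma> z\<close> invertible, so \<open>matrix_inv (\<sigma> z)\<close> is then the genuine inverse.
\<close>
definition ellip_class :: "real \<Rightarrow> real \<Rightarrow> (real^2) set \<Rightarrow> (real^2 \<Rightarrow> real^2^2) set" where
  "ellip_class \<alpha> \<beta> \<Omega> =
    {\<sigma>. \<sigma> \<in> borel_measurable (lebesgue_on \<Omega>) \<and>
        (AE z in lebesgue_on \<Omega>. \<forall>\<xi> :: real^2.
           (\<sigma> z *v \<xi>) \<bullet> \<xi> \<ge> \<alpha> * (norm \<xi>)\<^sup>2 \<and>
           (matrix_inv (\<sigma> z) *v \<xi>) \<bullet> \<xi> \<ge> inverse \<beta> * (norm \<xi>)\<^sup>2)}"

definition sigma_of :: "complex \<Rightarrow> complex \<Rightarrow> real^2^2" where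
  "sigma_of m n =
    (let D = (cmod (1 + n))\<^sup>2 - (cmod m)\<^sup>2 in
     vector
      [vector [((cmod (1 - m))\<^sup>2 - (cmod n)\<^sup>2) / D, 2 * Im (n - m) / D],
       vector [- 2 * Im (n + m) / D, ((cmod (1 + m))\<^sup>2 - (cmod n)\<^sup>2) / D]])"

definition mu_of :: "real^2^2 \<Rightarrow> complex" where
  "mu_of A =
    (of_real (A $ 2 $ 2 - A $ 1 $ 1) - \<i> * of_real (A $ 1 $ 2 + A $ 2 $ 1)) /
    of_real (1 + trace A + det A)"

definition nu_of :: "real^2^2 \<Rightarrow> complex" where
  "nu_of A =
    (of_real (1 - det A) + \<i> * of_real (A $ 1 $ 2 - A $ 2 $ 1)) /
    of_real (1 + trace A + det A)"

end

theory Submission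
  imports Defs
begin

text \<open>
  Identify the plane with the complex numbers. For a coefficient matrix \<open>A\<close>, a vector \<open>x\<close> and
  \<open>w = x + A x\<close>, the formulas that define \<open>\<mu>\<close> and \<open>\<nu>\<close> from \<open>A\<close>, and likewise those that define
  \<open>A\<close> from \<open>\<mu>\<close> and \<open>\<nu>\<close>, say, as long as
  their denominators do not vanish, that \<open>x - A x = \<nu> w + \<mu> cnj w\<close> for every \<open>x\<close>
  (\<open>beltrami_related_mu_nu\<close>, \<open>beltrami_related_sigma\<close>). So \<open>\<mu>\<close> and \<open>\<nu>\<close> are the two coefficients
  of the Cayley transform \<open>(1 - A) (1 + A)\<^sup>-\<^sup>1\<close> seen as a real-linear map of the complex plane. Its
  operator norm is \<open>\<bar>\<mu>\<bar> + \<bar>\<nu>\<bar>\<close>, because a suitable direction aligns the two terms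
  (\<open>beltrami_related_contraction\<close>, \<open>beltrami_related_bound\<close>).

  Thus, with \<open>k = (K - 1) / (K + 1)\<close>, the bound \<open>\<bar>\<mu>\<bar> + \<bar>\<nu>\<bar> \<le> k\<close> means
  \<open>\<bar>x - A x\<bar> \<le> k \<bar>x + A x\<bar>\<close> for all \<open>x\<close>. Squaring and expanding turns this into the symmetric
  energy inequality \<open>\<bar>x\<bar>\<^sup>2 + \<bar>A x\<bar>\<^sup>2 \<le> (K + 1/K) (A x \<bullet> x)\<close> (\<open>contraction_iff_coercive\<close>), and both
  parts compare it with the two inequalities that define the ellipticity class. The second of
  these, tested on \<open>A x\<close>, is a bound of \<open>A x \<bullet> x\<close> below by a multiple of \<open>\<bar>A x\<bar>\<^sup>2\<close>.

  From the energy inequality, Cauchy-Schwarz gives \<open>\<bar>x\<bar> \<le> K \<bar>A x\<bar>\<close> and \<open>\<bar>A x\<bar> \<le> K \<bar>x\<bar>\<close>, and inserting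
  these back bounds \<open>A x \<bullet> x\<close> below by \<open>\<bar>x\<bar>\<^sup>2 / K\<close> and by \<open>\<bar>A x\<bar>\<^sup>2 / K\<close> (\<open>coercive_split\<close>).
  Conversely, adding \<open>A x \<bullet> x \<ge> \<lambda> \<bar>x\<bar>\<^sup>2\<close> and \<open>A x \<bullet> x \<ge> \<lambda> \<bar>A x\<bar>\<^sup>2\<close> gives the energy inequality with
  \<open>2 / \<lambda>\<close> in place of \<open>K + 1/K\<close>, and \<open>K = (1 + sqrt (1 - \<lambda>\<^sup>2)) / \<lambda>\<close> is the root of
  \<open>K + 1/K = 2 / \<lambda>\<close> with \<open>K \<ge> 1\<close>.
\<close>

section \<open>The matrix and its Beltrami coefficients\<close>

definition complex_of_vec :: "real^2 \<Rightarrow> complex" where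
  "complex_of_vec x = Complex (x $ 1) (x $ 2)"

lemma norm_complex_of_vec: "cmod (complex_of_vec x) = norm x"
  by (simp add: complex_of_vec_def norm_vec_def L2_set_def sum_2 cmod_def)

lemma surj_complex_of_vec: "\<exists>x. complex_of_vec x = c"
  by (rule exI[of _ "vector [Re c, Im c]"]) (simp add: complex_of_vec_def)

text \<open>
  If \<open>x\<close> is the gradient of \<open>u\<close> and \<open>v\<close> is a stream function, so that the gradient of \<open>v\<close> is
  \<open>A x\<close> rotated counterclockwise by a right angle, then, writing \<open>\<partial>\<^sub>+\<close> and \<open>\<partial>\<^sub>-\<close> for the derivatives in \<open>z\<close> and in its conjugate, \<open>f = u + \<i> v\<close> has
  \<open>2 \<partial>\<^sub>+ f = cnj (x + A x)\<close> and \<open>2 \<partial>\<^sub>- f = x - A x\<close>; the relation below is the Beltrami equation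
  \<open>\<partial>\<^sub>- f = m \<partial>\<^sub>+ f + n cnj (\<partial>\<^sub>+ f)\<close>.
\<close>
definition beltrami_related :: "complex \<Rightarrow> complex \<Rightarrow> real^2^2 \<Rightarrow> bool" where
  "beltrami_related m n A \<longleftrightarrow> (\<forall>x.
     complex_of_vec (x - A *v x) =
       n * complex_of_vec (x + A *v x) + m * cnj (complex_of_vec (x + A *v x)))"

text \<open>The denominator is \<open>det (1 + A)\<close>, so it vanishes only if the Cayley transform is undefined.\<close>
lemma beltrami_related_mu_nu:
  assumes "1 + trace A + det A \<noteq> 0"
  shows "beltrami_related (mu_of A) (nu_of A) A"
proof -
  define D where "D = 1 + trace A + det A"
  have "D \<noteq> 0" and D: "D = 1 + (A$1$1 + A$2$2) + (A$1$1 * A$2$2 - A$1$2 * A$2$1)"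
    using assms by (simp_all add: D_def trace_def det_2 sum_2)
  define p q r s where "p = A$1$1" and "q = A$1$2" and "r = A$2$1" and "s = A$2$2"
  have "mu_of A = Complex ((s - p) / D) (- (q + r) / D)"
       "nu_of A = Complex ((1 - (p * s - q * r)) / D) ((q - r) / D)"
    by (simp_all add: mu_of_def nu_of_def complex_eq_iff Re_divide_of_real Im_divide_of_real
        flip: D_def, simp_all add: p_def q_def r_def s_def det_2)
  moreover have "D = 1 + (p + s) + (p * s - q * r)"
    using D by (simp add: p_def q_def r_def s_def)
  ultimately show ?thesis
    using \<open>D \<noteq> 0\<close>
    apply (simp add: beltrami_related_def complex_of_vec_def complex_eq_iff
        matrix_vector_mult_def sum_2 flip: p_def q_def r_def s_def)
    apply (simp add: divide_simps)
    by (simp add: algebra_simps)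
qed

lemma beltrami_related_sigma:
  assumes "(cmod (1 + n))\<^sup>2 - (cmod m)\<^sup>2 \<noteq> 0"
  shows "beltrami_related m n (sigma_of m n)"
proof -
  define D where "D = (cmod (1 + n))\<^sup>2 - (cmod m)\<^sup>2"
  obtain a b c d where mn: "m = Complex a b" "n = Complex c d"
    by (metis complex_surj)
  have "D \<noteq> 0" and D: "D = (1 + c)\<^sup>2 + d\<^sup>2 - (a\<^sup>2 + b\<^sup>2)"
    using assms by (simp_all add: D_def mn cmod_power2)
  have "sigma_of m n $ 1 $ 1 = ((1 - a)\<^sup>2 + b\<^sup>2 - (c\<^sup>2 + d\<^sup>2)) / D"
       "sigma_of m n $ 1 $ 2 = 2 * (d - b) / D"
       "sigma_of m n $ 2 $ 1 = - 2 * (d + b) / D"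
       "sigma_of m n $ 2 $ 2 = ((1 + a)\<^sup>2 + b\<^sup>2 - (c\<^sup>2 + d\<^sup>2)) / D"
    by (simp_all add: sigma_of_def Let_def flip: D_def) (simp_all add: mn cmod_power2)
  then show ?thesis
    using \<open>D \<noteq> 0\<close>
    apply (simp add: beltrami_related_def complex_of_vec_def complex_eq_iff
        matrix_vector_mult_def sum_2 mn)
    apply (simp add: divide_simps)
    apply (simp add: D power2_eq_square)
    by (simp add: algebra_simps)
qed

section \<open>The operator norm of the Cayley transform\<close>

text \<open>
  On the unit circle the two terms have equal arguments iff \<open>u\<^sup>2\<close> points in the direction of
  \<open>m * cnj n\<close>, so a square root of that direction is a maximiser.
\<close>
lemma exists_aligning_direction:
  "\<exists>u. cmod u = 1 \<and> cmod (n * u + m * cnj u) = cmod m + cmod n"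
proof (cases "m = 0 \<or> n = 0")
  case True
  then show ?thesis
    by (intro exI[of _ 1]) auto
next
  case False
  define u where "u = csqrt (sgn m * cnj (sgn n))"
  have u2: "u\<^sup>2 = sgn m * cnj (sgn n)"
    by (simp add: u_def)
  have "(cmod u)\<^sup>2 = cmod (u\<^sup>2)"
    by (simp add: norm_power)
  also have "\<dots> = 1"
    unfolding u2 using False by (simp add: norm_mult norm_sgn)
  finally have u1: "cmod u = 1"
    by (simp add: power2_eq_1_iff)
      (metis abs_norm_cancel abs_minus_cancel abs_one)
  then have uu: "u * cnj u = 1" by (simp add: complex_norm_square[symmetric])
  have sn: "sgn n * cnj (sgn n) = 1"
    using False by (simp add: complex_norm_square[symmetric] norm_sgn)
  have m: "m = of_real (cmod m) * sgn m" and n: "n = of_real (cmod n) * sgn n"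
    using False by (simp_all add: sgn_eq)
  have "u\<^sup>2 * sgn n = sgn m * (sgn n * cnj (sgn n))"
    unfolding u2 by (simp only: mult_ac)
  then have "sgn m = u\<^sup>2 * sgn n"
    unfolding sn by simp
  then have "sgn m * cnj u = u * sgn n * (u * cnj u)" by (simp add: power2_eq_square algebra_simps)
  then have al: "sgn m * cnj u = u * sgn n" using uu by simp
  have "n * u + m * cnj u = of_real (cmod n) * (u * sgn n) + of_real (cmod m) * (sgn m * cnj u)"
    by (subst m, subst n) (simp only: mult.assoc mult.left_commute[of u] mult.commute[of _ u])
  also have "\<dots> = of_real (cmod m + cmod n) * (u * sgn n)"
    unfolding al by (simp add: algebra_simps)
  finally have "cmod (n * u + m * cnj u) = \<bar>cmod m + cmod n\<bar> * cmod (u * sgn n)"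
    by (metis norm_mult norm_of_real)
  then show ?thesis using u1 False by (intro exI[of _ u]) (simp add: norm_mult norm_sgn)
qed

lemma beltrami_related_contraction:
  assumes "beltrami_related m n A"
  shows "norm (x - A *v x) \<le> (cmod m + cmod n) * norm (x + A *v x)"
proof -
  let ?w = "complex_of_vec (x + A *v x)"
  have "norm (x - A *v x) = cmod (n * ?w + m * cnj ?w)"
    using assms by (metis beltrami_related_def norm_complex_of_vec)
  also have "\<dots> \<le> cmod n * cmod ?w + cmod m * cmod ?w"
    by (metis norm_triangle_ineq norm_mult complex_mod_cnj)
  finally show ?thesis by (simp add: norm_complex_of_vec algebra_simps)
qed

text \<open>
  Invertibility of \<open>1 + A\<close> makes every direction \<open>w\<close> of the form \<open>x + A x\<close>, in particular the
  one in which the terms \<open>n w\<close> and \<open>m cnj w\<close> add up without cancellation.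
\<close>
lemma beltrami_related_bound:
  assumes "beltrami_related m n A" and "invertible (mat 1 + A)"
    and "\<And>x. norm (x - A *v x) \<le> k * norm (x + A *v x)"
  shows "cmod m + cmod n \<le> k"
proof -
  obtain u where u: "cmod u = 1" "cmod (n * u + m * cnj u) = cmod m + cmod n"
    using exists_aligning_direction by blast
  obtain y where y: "complex_of_vec y = u" using surj_complex_of_vec by blast
  obtain B where "(mat 1 + A) ** B = mat 1"
    using assms(2) invertible_right_inverse by blast
  then have x: "B *v y + A *v (B *v y) = y"
    by (metis matrix_vector_mul_assoc matrix_vector_mul_lid matrix_vector_mult_add_rdistrib)
  have "cmod m + cmod n = norm (B *v y - A *v (B *v y))"
    using assms(1) u(2) x y unfolding beltrami_related_def by (metis norm_complex_of_vec)
  also have "\<dots> \<le> k * norm y"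
    using assms(3)[of "B *v y"] x by simp
  finally show ?thesis using u(1) y by (metis norm_complex_of_vec mult.right_neutral)
qed

section \<open>Contraction and coercivity\<close>

text \<open>
  After squaring, the cross terms combine with \<open>(K + 1)\<^sup>2 + (K - 1)\<^sup>2 = 2 (K\<^sup>2 + 1)\<close> and the square
  terms with \<open>(K + 1)\<^sup>2 - (K - 1)\<^sup>2 = 4 K\<close>. The right-hand side is symmetric in \<open>x\<close> and \<open>y\<close>, which
  is why it controls a matrix and its inverse alike.
\<close>
lemma contraction_iff_coercive:
  fixes x y :: "'a::real_inner"
  assumes "K \<ge> 1"
  shows "norm (x - y) \<le> (K - 1) / (K + 1) * norm (x + y) \<longleftrightarrow>
         K * ((norm x)\<^sup>2 + (norm y)\<^sup>2) \<le> (K\<^sup>2 + 1) * (y \<bullet> x)"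
proof -
  have norm_diff: "(norm (x - y))\<^sup>2 = (norm x)\<^sup>2 + (norm y)\<^sup>2 - 2 * (y \<bullet> x)"
    and norm_add: "(norm (x + y))\<^sup>2 = (norm x)\<^sup>2 + (norm y)\<^sup>2 + 2 * (y \<bullet> x)"
    by (simp_all add: power2_norm_eq_inner inner_simps inner_commute[of x y])
  have "norm (x - y) \<le> (K - 1) / (K + 1) * norm (x + y) \<longleftrightarrow>
        (K + 1) * norm (x - y) \<le> (K - 1) * norm (x + y)"
    using assms by (simp add: field_simps)
  also have "\<dots> \<longleftrightarrow> ((K + 1) * norm (x - y))\<^sup>2 \<le> ((K - 1) * norm (x + y))\<^sup>2"
    using assms by (subst abs_le_square_iff[symmetric]) simp
  also have "\<dots> \<longleftrightarrow> (K + 1)\<^sup>2 * ((norm x)\<^sup>2 + (norm y)\<^sup>2 - 2 * (y \<bullet> x))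
                \<le> (K - 1)\<^sup>2 * ((norm x)\<^sup>2 + (norm y)\<^sup>2 + 2 * (y \<bullet> x))"
    by (simp add: power_mult_distrib norm_diff norm_add)
  also have "\<dots> \<longleftrightarrow> 4 * (K * ((norm x)\<^sup>2 + (norm y)\<^sup>2)) \<le> 4 * ((K\<^sup>2 + 1) * (y \<bullet> x))"
    by (simp add: power2_eq_square algebra_simps)
  also have "\<dots> \<longleftrightarrow> K * ((norm x)\<^sup>2 + (norm y)\<^sup>2) \<le> (K\<^sup>2 + 1) * (y \<bullet> x)"
    by simp
  finally show ?thesis .
qed

text \<open>
  By Cauchy-Schwarz the hypothesis gives \<open>(\<bar>x\<bar> - K \<bar>y\<bar>) (K \<bar>x\<bar> - \<bar>y\<bar>) \<le> 0\<close>, but both factors would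
  be positive if the conclusion failed.
\<close>
lemma norm_ratio_bound:
  fixes x y :: "'a::real_inner"
  assumes "K \<ge> 1" and "K * ((norm x)\<^sup>2 + (norm y)\<^sup>2) \<le> (K\<^sup>2 + 1) * (y \<bullet> x)"
  shows "norm x \<le> K * norm y"
proof (rule ccontr)
  assume "\<not> norm x \<le> K * norm y"
  then have a: "norm x > K * norm y" by simp
  have "norm x \<ge> norm y"
    using a assms(1) mult_right_mono[of 1 K "norm y"] by simp
  moreover have "(norm y) \<le> K * norm y"
    using assms(1) mult_right_mono[of 1 K "norm y"] by simp
  ultimately have b: "K * norm x > norm y"
    using a assms(1) mult_right_mono[of 1 K "norm x"] by simp
  have "(norm x - K * norm y) * (K * norm x - norm y) > 0"
    using a b by simp
  then have "K * ((norm x)\<^sup>2 + (norm y)\<^sup>2) > (K\<^sup>2 + 1) * (norm y * norm x)"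
    by (simp add: power2_eq_square algebra_simps)
  moreover have "(K\<^sup>2 + 1) * (y \<bullet> x) \<le> (K\<^sup>2 + 1) * (norm y * norm x)"
    by (intro mult_left_mono norm_cauchy_schwarz) simp
  ultimately show False using assms(2) by simp
qed

text \<open>
  The symmetric hypothesis also yields the same bound with \<open>x\<close> and \<open>y\<close> exchanged: used with
  \<open>y = A x\<close>, the two versions are the ellipticity of \<open>A\<close> and of its inverse.
\<close>
lemma coercive_split:
  fixes x y :: "'a::real_inner"
  assumes K: "K \<ge> 1" and co: "K * ((norm x)\<^sup>2 + (norm y)\<^sup>2) \<le> (K\<^sup>2 + 1) * (y \<bullet> x)"
  shows "y \<bullet> x \<ge> 1 / K * (norm x)\<^sup>2"
proof -
  have "(norm x)\<^sup>2 \<le> K\<^sup>2 * (norm y)\<^sup>2"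
    using norm_ratio_bound[OF assms]
    by (metis norm_ge_zero power_mono power_mult_distrib)
  then have "(K\<^sup>2 + 1) * (norm x)\<^sup>2 \<le> K * (K * ((norm x)\<^sup>2 + (norm y)\<^sup>2))"
    by (simp add: power2_eq_square algebra_simps)
  also have "\<dots> \<le> K * ((K\<^sup>2 + 1) * (y \<bullet> x))"
    using K co by (intro mult_left_mono) auto
  finally have "(K\<^sup>2 + 1) * (norm x)\<^sup>2 \<le> (K\<^sup>2 + 1) * (K * (y \<bullet> x))"
    by (simp add: algebra_simps)
  then have "(norm x)\<^sup>2 \<le> K * (y \<bullet> x)"
    by (rule mult_left_le_imp_le) (simp add: add_nonneg_pos)
  then show ?thesis using K by (simp add: field_simps)
qed

section \<open>Pointwise ellipticity\<close>

lemma coercive_imp_invertible: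
  fixes A :: "real^'n^'n"
  assumes "c > 0" and "\<And>x. (A *v x) \<bullet> x \<ge> c * (norm x)\<^sup>2"
  shows "invertible A"
proof -
  have "x = 0" if "A *v x = 0" for x
  proof -
    have "c * (norm x)\<^sup>2 \<le> 0" using assms(2)[of x] that by simp
    then show ?thesis using assms(1) by (simp add: mult_le_0_iff)
  qed
  then show ?thesis
    using invertible_left_inverse matrix_left_invertible_ker by blast
qed

lemma
  fixes A :: "real^'n^'n"
  assumes "invertible A"
  shows matrix_mul_matrix_inv: "A ** matrix_inv A = mat 1"
    and matrix_inv_matrix_mul: "matrix_inv A ** A = mat 1"
  using someI_ex[OF assms[unfolded invertible_def]] by (simp_all add: matrix_inv_def)

lemma borel_measurable_sigma_of:
  assumes [measurable]: "\<mu> \<in> borel_measurable M" "\<nu> \<in> borel_measurable M"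
  shows "(\<lambda>z. sigma_of (\<mu> z) (\<nu> z)) \<in> borel_measurable M"
proof (subst borel_measurable_euclidean_space, intro ballI)
  fix b :: "real^2^2" assume "b \<in> Basis"
  then obtain i j where b: "b = axis i (axis j 1)"
    by (auto simp: Basis_vec_def)
  have [measurable]: "Re \<in> borel_measurable borel" "Im \<in> borel_measurable borel"
    by (auto intro!: borel_measurable_continuous_onI continuous_intros)
  show "(\<lambda>z. sigma_of (\<mu> z) (\<nu> z) \<bullet> b) \<in> borel_measurable M"
    using exhaust_2[of i] exhaust_2[of j]
    by (auto simp: b inner_axis sigma_of_def Let_def)
qed

text \<open>
  Since \<open>k = (K - 1) / (K + 1) < 1\<close>, the bound on the coefficients already forces
  \<open>\<bar>m\<bar> < 1 - \<bar>n\<bar> \<le> \<bar>1 + n\<bar>\<close>, so the denominator in the matrix is positive. The estimate for the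
  inverse is the one for the matrix with the two vectors exchanged.
\<close>
lemma ellipticity_of_sigma_of:
  assumes K: "K \<ge> 1" and k: "cmod m + cmod n \<le> (K - 1) / (K + 1)"
  shows "(sigma_of m n *v x) \<bullet> x \<ge> 1 / K * (norm x)\<^sup>2"
    and "(matrix_inv (sigma_of m n) *v x) \<bullet> x \<ge> inverse K * (norm x)\<^sup>2"
proof -
  let ?A = "sigma_of m n"
  have "(K - 1) / (K + 1) < 1" using K by simp
  then have "cmod m < 1 - cmod n" using k by simp
  also have "\<dots> \<le> cmod (1 + n)"
    using norm_diff_ineq[of 1 n] by simp
  finally have "(cmod m)\<^sup>2 < (cmod (1 + n))\<^sup>2" by (simp add: power_strict_mono)
  then have rel: "beltrami_related m n ?A" by (intro beltrami_related_sigma) linarith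
  have co: "K * ((norm y)\<^sup>2 + (norm (?A *v y))\<^sup>2) \<le> (K\<^sup>2 + 1) * ((?A *v y) \<bullet> y)" for y
    using beltrami_related_contraction[OF rel, of y] mult_right_mono[OF k, of "norm (y + ?A *v y)"]
    by (subst contraction_iff_coercive[OF K, symmetric]) auto
  show lower: "(?A *v y) \<bullet> y \<ge> 1 / K * (norm y)\<^sup>2" for y
    using K co by (rule coercive_split)
  have "invertible ?A"
    using K lower by (intro coercive_imp_invertible[of "1 / K"]) auto
  then have inv: "?A *v (matrix_inv ?A *v x) = x"
    by (metis matrix_mul_matrix_inv matrix_vector_mul_assoc matrix_vector_mul_lid)
  have "(matrix_inv ?A *v x) \<bullet> x \<ge> 1 / K * (norm x)\<^sup>2"
    using co[of "matrix_inv ?A *v x"] unfolding inv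
    by (intro coercive_split[OF K]) (simp add: inner_commute add.commute)
  then show "(matrix_inv ?A *v x) \<bullet> x \<ge> inverse K * (norm x)\<^sup>2"
    by (simp add: inverse_eq_divide)
qed

text \<open>
  The constant \<open>K\<close> solves \<open>l (K\<^sup>2 + 1) = 2 K\<close>, which is what makes the sum of the two ellipticity
  inequalities coincide with the coercive form of the contraction inequality.
\<close>
lemma beltrami_bound_of_elliptic:
  assumes l: "0 < l" "l \<le> 1" and K: "K = (1 + sqrt (1 - l\<^sup>2)) / l"
    and A: "\<And>x. (A *v x) \<bullet> x \<ge> l * (norm x)\<^sup>2"
    and A_inv: "\<And>x. (matrix_inv A *v x) \<bullet> x \<ge> l * (norm x)\<^sup>2"
  shows "cmod (mu_of A) + cmod (nu_of A) \<le> (K - 1) / (K + 1)"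
proof -
  define s where "s = sqrt (1 - l\<^sup>2)"
  have s: "s\<^sup>2 = 1 - l\<^sup>2" "s \<ge> 0"
    using l by (auto simp: s_def power_le_one)
  have lK: "l * K = 1 + s" using l K by (simp add: s_def)
  have K1: "K \<ge> 1" using l s(2) unfolding K s_def[symmetric] by (simp add: field_simps)
  have "l * (l * (K\<^sup>2 + 1)) = l * (2 * K)"
  proof -
    have "l * (l * (K\<^sup>2 + 1)) = (l * K)\<^sup>2 + l\<^sup>2"
      by (simp add: power2_eq_square algebra_simps)
    also have "\<dots> = 2 * (1 + s)"
      unfolding lK using s(1) by (simp add: power2_eq_square algebra_simps)
    finally show ?thesis using lK by simp
  qed
  then have Kl: "l * (K\<^sup>2 + 1) = 2 * K" using l by simp
  have "invertible A" using l A by (rule_tac coercive_imp_invertible)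
  then have inv: "matrix_inv A *v (A *v x) = x" for x
    by (metis matrix_inv_matrix_mul matrix_vector_mul_assoc matrix_vector_mul_lid)
  have co: "K * ((norm x)\<^sup>2 + (norm (A *v x))\<^sup>2) \<le> (K\<^sup>2 + 1) * ((A *v x) \<bullet> x)" for x
  proof -
    have "l * ((norm x)\<^sup>2 + (norm (A *v x))\<^sup>2) \<le> 2 * ((A *v x) \<bullet> x)"
      using A[of x] A_inv[of "A *v x"] unfolding inv by (simp add: inner_commute algebra_simps)
    then have "(K\<^sup>2 + 1) * (l * ((norm x)\<^sup>2 + (norm (A *v x))\<^sup>2))
        \<le> (K\<^sup>2 + 1) * (2 * ((A *v x) \<bullet> x))"
      by (rule mult_left_mono) simp
    moreover have "(K\<^sup>2 + 1) * (l * ((norm x)\<^sup>2 + (norm (A *v x))\<^sup>2))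
        = 2 * K * ((norm x)\<^sup>2 + (norm (A *v x))\<^sup>2)"
      by (simp add: Kl flip: mult.assoc) (simp add: Kl mult.commute[of "K\<^sup>2 + 1"])
    ultimately show ?thesis by simp
  qed
  have inv1: "invertible (mat 1 + A)"
  proof (rule coercive_imp_invertible)
    show "1 * (norm x)\<^sup>2 \<le> ((mat 1 + A) *v x) \<bullet> x" for x
    proof -
      have "0 \<le> l * (norm x)\<^sup>2" using l by simp
      then have "0 \<le> (A *v x) \<bullet> x" using A[of x] by linarith
      then show ?thesis
        by (simp add: matrix_vector_mult_add_rdistrib inner_add_left power2_norm_eq_inner)
    qed
  qed simp
  have "det (mat 1 + A) = 1 + trace A + det A"
    by (simp add: det_2 trace_def sum_2 mat_def algebra_simps)
  then have "1 + trace A + det A \<noteq> 0"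
    using inv1 by (simp add: invertible_det_nz)
  then have "beltrami_related (mu_of A) (nu_of A) A" by (rule beltrami_related_mu_nu)
  then show ?thesis
    using inv1
  proof (rule beltrami_related_bound)
    show "norm (x - A *v x) \<le> (K - 1) / (K + 1) * norm (x + A *v x)" for x
      using co contraction_iff_coercive[OF K1] by blast
  qed
qed

theorem proposition1p8:
  fixes \<Omega> :: "(real^2) set"
  assumes "open \<Omega>" and "bounded \<Omega>" and "simply_connected \<Omega>"
  shows "(\<forall>(K::real) (\<mu> :: real^2 \<Rightarrow> complex) (\<nu> :: real^2 \<Rightarrow> complex).
            K \<ge> 1 \<longrightarrow>
            \<mu> \<in> borel_measurable (lebesgue_on \<Omega>) \<longrightarrow>
            \<nu> \<in> borel_measurable (lebesgue_on \<Omega>) \<longrightarrow>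
            (AE z in lebesgue_on \<Omega>. cmod (\<mu> z) + cmod (\<nu> z) \<le> (K - 1) / (K + 1)) \<longrightarrow>
            (\<lambda>z. sigma_of (\<mu> z) (\<nu> z)) \<in> ellip_class (1 / K) K \<Omega>)
       \<and> (\<forall>(l::real) (\<sigma> :: real^2 \<Rightarrow> real^2^2) (K::real).
            0 < l \<longrightarrow> l \<le> 1 \<longrightarrow>
            \<sigma> \<in> ellip_class l (1 / l) \<Omega> \<longrightarrow>
            K = (1 + sqrt (1 - l\<^sup>2)) / l \<longrightarrow>
            (AE z in lebesgue_on \<Omega>.
               cmod (mu_of (\<sigma> z)) + cmod (nu_of (\<sigma> z)) \<le> (K - 1) / (K + 1)))"
proof (intro conjI allI impI)
  fix K :: real and \<mu> \<nu> :: "real^2 \<Rightarrow> complex"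
  assume K: "K \<ge> 1" and meas: "\<mu> \<in> borel_measurable (lebesgue_on \<Omega>)"
      "\<nu> \<in> borel_measurable (lebesgue_on \<Omega>)"
    and bound: "AE z in lebesgue_on \<Omega>. cmod (\<mu> z) + cmod (\<nu> z) \<le> (K - 1) / (K + 1)"
  have "AE z in lebesgue_on \<Omega>. \<forall>\<xi>.
      (sigma_of (\<mu> z) (\<nu> z) *v \<xi>) \<bullet> \<xi> \<ge> 1 / K * (norm \<xi>)\<^sup>2 \<and>
      (matrix_inv (sigma_of (\<mu> z) (\<nu> z)) *v \<xi>) \<bullet> \<xi> \<ge> inverse K * (norm \<xi>)\<^sup>2"
    using bound by eventually_elim (use ellipticity_of_sigma_of[OF K] in blast)
  then show "(\<lambda>z. sigma_of (\<mu> z) (\<nu> z)) \<in> ellip_class (1 / K) K \<Omega>"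
    using borel_measurable_sigma_of[OF meas] by (simp add: ellip_class_def)
next
  fix l K :: real and \<sigma> :: "real^2 \<Rightarrow> real^2^2"
  assume l: "0 < l" "l \<le> 1" and \<sigma>: "\<sigma> \<in> ellip_class l (1 / l) \<Omega>"
    and K: "K = (1 + sqrt (1 - l\<^sup>2)) / l"
  have "AE z in lebesgue_on \<Omega>. \<forall>\<xi>.
      (\<sigma> z *v \<xi>) \<bullet> \<xi> \<ge> l * (norm \<xi>)\<^sup>2 \<and> (matrix_inv (\<sigma> z) *v \<xi>) \<bullet> \<xi> \<ge> l * (norm \<xi>)\<^sup>2"
    using \<sigma> by (simp add: ellip_class_def)
  then show "AE z in lebesgue_on \<Omega>.
      cmod (mu_of (\<sigma> z)) + cmod (nu_of (\<sigma> z)) \<le> (K - 1) / (K + 1)"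
    by eventually_elim (use beltrami_bound_of_elliptic[OF l K] in blast)
qed

end
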